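(* The following hold: (1) $\displaystyle \int_0^1\frac{\sin^{-1}x\,\cos^{-1}x}{x}\,dx=\frac78\zeta(3)$; (2) $\displaystyle \frac2\pi\int_0^1\frac{\frac12(\sin^{-1}x)^2\cos^{-1}x}{x}\,dx=\frac18\zeta(3)$; (3) $\displaystyle \int_0^1\frac{\left(\sin^{-1}x+\frac1\pi(\sin^{-1}x)^2\right)\cos^{-1}x}{x}\,dx=\zeta(3)$; (4) $\displaystyle \int_0^1\frac{\sinh^{-1}x\,\cos^{-1}x}{x}\,dx=\frac{\pi^3}{32}$; (5) $\displaystyle \int_0^1\frac{\frac12(\sinh^{-1}x)^2\cos^{-1}x}{x}\,dx=\frac{3\pi}{64}\zeta(3)$.
   Context: $\zeta$ is the Riemann zeta function. $\sin^{-1}$ is the real inverse sine with values in $[-\pi/2,\pi/2]$, $\cos^{-1}$ is the real inverse cosine with values in $[0,\pi]$, and $\sinh^{-1}x=\log(x+\sqrt{x^2+1})$. *)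

theory Defs
  imports "HOL-Analysis.Analysis"
begin

text \<open>
  The Riemann zeta function: the Dirichlet series on the half-plane of absolute convergence and
  its analytic continuation elsewhere. The continuation is unique off \<open>1\<close>; the value
  at the pole \<open>1\<close> is unspecified.
\<close>

definition zeta_series :: "complex \<Rightarrow> complex" where
  "zeta_series s = (\<Sum>n. 1 / of_nat (Suc n) powr s)"

definition zeta :: "complex \<Rightarrow> complex" where
  "zeta s = (if Re s > 1 then zeta_series s
     else (THE z. \<exists>f. f holomorphic_on (- {1}) \<and>
                      (\<forall>w. Re w > 1 \<longrightarrow> f w = zeta_series w) \<and> f s = z))"

end

theory Submission
  imports Defs
begin

text \<open>
  The inverse sine and the inverse hyperbolic sine are the functions \<open>F\<close> with \<open>F 0 = 0\<close>
  and \<open>F' x = 1 / sqrt (1 - s x\<^sup>2)\<close> for \<open>s = 1\<close> and \<open>s = -1\<close>. For either of them,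
  \<open>Y = \<alpha> F + \<beta> F\<^sup>2 / 2\<close> satisfies the linear equation
  \<open>(1 - s x\<^sup>2) Y'' - s x Y' = \<beta>\<close>, so that its Taylor coefficients obey
  \<open>(n + 1) (n + 2) c\<^bsub>n+2\<^esub> = s n\<^sup>2 c\<^sub>n\<close>, with \<open>\<beta>\<close> added on the right for \<open>n = 0\<close>
  (lemma \<open>ode_power_series_eq\<close>).

  Integration by parts reduces the moment of order \<open>n\<close> of \<open>arccos\<close> to
  \<open>W\<^bsub>n+1\<^esub> / (n + 1)\<close>, where \<open>W\<^sub>n\<close> is the Wallis integral of \<open>x\<^sup>n / sqrt (1 - x\<^sup>2)\<close> and satisfies
  \<open>W\<^bsub>n+2\<^esub> = (n + 1) / (n + 2) W\<^sub>n\<close>. The two recursions fit together: \<open>n\<^sup>2 c\<^sub>n W\<^sub>n\<close> is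
  merely multiplied by \<open>s\<close> when \<open>n\<close> increases by 2 (lemma \<open>ode_coeff_times_wallis\<close>). Integrating
  the power series of \<open>Y x / x\<close> against \<open>arccos\<close> term by term therefore yields a combination of
  sums of \<open>\<plusminus>1 / n\<^sup>3\<close>: the odd \<open>n\<close> carry \<open>\<alpha>\<close>, the even \<open>n\<close> carry \<open>\<beta> \<pi> / 2\<close>, and the signs
  alternate within each parity class if \<open>s = -1\<close> (lemma \<open>arc_quadratic_times_arccos_has_integral\<close>).

  All five integrals are instances. Three of the four sums involved are rational multiples of
  \<open>\<zeta>(3)\<close> by splitting into even and odd indices. The fourth,
  \<open>1 - 1 / 3\<^sup>3 + 1 / 5\<^sup>3 - \<dots> = \<pi>\<^sup>3 / 32\<close>, is obtained from the third logarithmic derivative of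
  \<open>\<Gamma>(x) \<Gamma>(1 - x) = \<pi> / sin (\<pi> x)\<close> at \<open>x = 1 / 4\<close>.
\<close>


section \<open>Power series of quadratic polynomials in the inverse sine functions\<close>

lemma DERIV_sqrt_one_minus:
  fixes s t :: real
  assumes "1 - s * t\<^sup>2 > 0"
  shows "((\<lambda>x. sqrt (1 - s * x\<^sup>2)) has_real_derivative - (s * t) / sqrt (1 - s * t\<^sup>2)) (at t)"
proof -
  have "((\<lambda>x. 1 - s * x\<^sup>2) has_real_derivative - (2 * s * t)) (at t)"
    by (auto intro!: derivative_eq_intros)
  from DERIV_chain2[OF DERIV_real_sqrt[OF assms] this] show ?thesis
    by (simp add: field_simps)
qed

text \<open>
  The recursion says that the sum \<open>Y\<close> of the series solves
  \<open>(1 - s x\<^sup>2) Y'' - s x Y' = \<beta>\<close>. Dividing by \<open>sqrt (1 - s x\<^sup>2)\<close> turns the left-hand side into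
  the derivative of \<open>sqrt (1 - s x\<^sup>2) Y'\<close> and the right-hand side into \<open>\<beta> F'\<close>. Hence
  \<open>Y' = (c\<^sub>1 + \<beta> F) F'\<close>, which integrates to the claim.
\<close>

lemma ode_power_series_eq:
  fixes c :: "nat \<Rightarrow> real" and F :: "real \<Rightarrow> real" and s x \<beta> :: real
  assumes s: "\<bar>s\<bar> \<le> 1"
    and summ: "\<And>x. \<bar>x\<bar> < 1 \<Longrightarrow> summable (\<lambda>n. c n * x ^ n)"
    and rec: "\<And>n. real (n + 1) * real (n + 2) * c (n + 2) = s * (real n)\<^sup>2 * c n + (if n = 0 then \<beta> else 0)"
    and F0: "F 0 = 0"
    and F': "\<And>x. \<bar>x\<bar> < 1 \<Longrightarrow> (F has_real_derivative 1 / sqrt (1 - s * x\<^sup>2)) (at x)"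
    and x: "\<bar>x\<bar> < 1"
  shows "(\<Sum>n. c n * x ^ n) = c 0 + c 1 * F x + \<beta> / 2 * (F x)\<^sup>2"
proof -
  define Y where "Y = (\<lambda>x. \<Sum>n. c n * x ^ n)"
  define Y1 where "Y1 = (\<lambda>x. \<Sum>n. diffs c n * x ^ n)"
  define Y2 where "Y2 = (\<lambda>x. \<Sum>n. diffs (diffs c) n * x ^ n)"
  have summ1: "summable (\<lambda>n. diffs c n * x ^ n)" if "\<bar>x\<bar> < 1" for x
    by (rule termdiff_converges[where K = 1]) (use that summ in auto)
  have summ2: "summable (\<lambda>n. diffs (diffs c) n * x ^ n)" if "\<bar>x\<bar> < 1" for x
    by (rule termdiff_converges[where K = 1]) (use that summ1 in auto)
  have DY: "(Y has_real_derivative Y1 x) (at x)" if "\<bar>x\<bar> < 1" for x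
    unfolding Y_def Y1_def by (rule termdiffs_strong'[where K = 1]) (use that summ in auto)
  have DY1: "(Y1 has_real_derivative Y2 x) (at x)" if "\<bar>x\<bar> < 1" for x
    unfolding Y2_def Y1_def by (rule termdiffs_strong'[where K = 1]) (use that summ1 in auto)
  have ode: "(1 - s * x\<^sup>2) * Y2 x - s * x * Y1 x = \<beta>" if x: "\<bar>x\<bar> < 1" for x
  proof -
    (* Each of Y'', x Y' and x^2 Y'' is written as a series in x^n with the same exponent, so
       that the recursion can be read off coefficient by coefficient. *)
    have a: "(\<lambda>n. diffs (diffs c) n * x ^ n) sums Y2 x"
      unfolding Y2_def by (rule summable_sums[OF summ2[OF x]])
    have "(\<lambda>n. x * (real n * c n * x ^ (n - Suc 0))) sums (x * Y1 x)"
      unfolding Y1_def using diffs_equiv[OF summ1[OF x]] by (intro sums_mult) simp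
    also have "(\<lambda>n. x * (real n * c n * x ^ (n - Suc 0))) = (\<lambda>n. real n * c n * x ^ n)"
    proof
      show "x * (real n * c n * x ^ (n - Suc 0)) = real n * c n * x ^ n" for n
        by (cases n) auto
    qed
    finally have b: "(\<lambda>n. real n * c n * x ^ n) sums (x * Y1 x)" .
    have "(\<lambda>n. x\<^sup>2 * (real n * diffs c n * x ^ (n - Suc 0))) sums (x\<^sup>2 * Y2 x)"
      unfolding Y2_def using diffs_equiv[OF summ2[OF x]] by (intro sums_mult) simp
    also have "(\<lambda>n. x\<^sup>2 * (real n * diffs c n * x ^ (n - Suc 0))) =
        (\<lambda>n. real (Suc n) * real n * c (Suc n) * x ^ Suc n)"
    proof
      show "x\<^sup>2 * (real n * diffs c n * x ^ (n - Suc 0)) = real (Suc n) * real n * c (Suc n) * x ^ Suc n" for n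
        by (cases n) (auto simp: diffs_def power2_eq_square algebra_simps)
    qed
    finally have "(\<lambda>n. real (Suc n) * real (Suc n - 1) * c (Suc n) * x ^ Suc n) sums (x\<^sup>2 * Y2 x)"
      by simp
    hence d: "(\<lambda>n. real n * real (n - 1) * c n * x ^ n) sums (x\<^sup>2 * Y2 x)"
      by (subst (asm) sums_Suc_iff) simp
    have "(\<lambda>n. diffs (diffs c) n * x ^ n - s * (real n * real (n - 1) * c n * x ^ n)
             - s * (real n * c n * x ^ n)) sums (Y2 x - s * (x\<^sup>2 * Y2 x) - s * (x * Y1 x))"
      by (intro sums_diff sums_mult a b d)
    also have "(\<lambda>n. diffs (diffs c) n * x ^ n - s * (real n * real (n - 1) * c n * x ^ n)
             - s * (real n * c n * x ^ n)) = (\<lambda>n. if n = 0 then \<beta> * x ^ n else 0)"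
    proof
      fix n
      have "diffs (diffs c) n = s * (real n)\<^sup>2 * c n + (if n = 0 then \<beta> else 0)"
        using rec[of n] by (simp add: diffs_def algebra_simps)
      moreover have "(real n)\<^sup>2 = real n * real (n - 1) + real n"
        by (cases n) (auto simp: power2_eq_square algebra_simps)
      ultimately show "diffs (diffs c) n * x ^ n - s * (real n * real (n - 1) * c n * x ^ n)
             - s * (real n * c n * x ^ n) = (if n = 0 then \<beta> * x ^ n else 0)"
        by (auto simp: algebra_simps)
    qed
    finally have "(\<lambda>n. if n = 0 then \<beta> * x ^ n else 0) sums (Y2 x - s * (x\<^sup>2 * Y2 x) - s * (x * Y1 x))" .
    moreover have "(\<lambda>n. if n = 0 then \<beta> * x ^ n else 0) sums (\<beta> * x ^ 0)"
      by (rule sums_single)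
    ultimately show ?thesis
      using sums_unique2 by (fastforce simp: algebra_simps)
  qed
  have pos: "1 - s * x\<^sup>2 > 0" if "\<bar>x\<bar> < 1" for x
  proof -
    have "\<bar>s * x\<^sup>2\<bar> \<le> 1 * x\<^sup>2" unfolding abs_mult using s by (intro mult_mono) auto
    moreover have "x\<^sup>2 < 1" using that by (simp add: abs_square_less_1)
    ultimately show ?thesis by linarith
  qed
  have Y1: "sqrt (1 - s * x\<^sup>2) * Y1 x = c 1 + \<beta> * F x" if x: "\<bar>x\<bar> < 1" for x
  proof -
    have const: "(\<lambda>x. sqrt (1 - s * x\<^sup>2) * Y1 x - \<beta> * F x) x = (\<lambda>x. sqrt (1 - s * x\<^sup>2) * Y1 x - \<beta> * F x) 0"
    proof (rule DERIV_isconst3[of "-1" 1 x 0 "\<lambda>x. sqrt (1 - s * x\<^sup>2) * Y1 x - \<beta> * F x"])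
      fix t :: real assume "t \<in> {-1<..<1}"
      hence t: "\<bar>t\<bar> < 1" by auto
      have p: "1 - s * t\<^sup>2 > 0" by (rule pos[OF t])
      hence q: "sqrt (1 - s * t\<^sup>2) * sqrt (1 - s * t\<^sup>2) = 1 - s * t\<^sup>2" "sqrt (1 - s * t\<^sup>2) > 0" by auto
      have "((\<lambda>x. sqrt (1 - s * x\<^sup>2) * Y1 x - \<beta> * F x) has_real_derivative
          ((1 - s * t\<^sup>2) * Y2 t - s * t * Y1 t - \<beta>) / sqrt (1 - s * t\<^sup>2)) (at t)"
      proof -
        have root: "((\<lambda>x. sqrt (1 - s * x\<^sup>2)) has_real_derivative - (s * t) / sqrt (1 - s * t\<^sup>2)) (at t)"
          by (rule DERIV_sqrt_one_minus[OF p])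
        have "Y2 t * sqrt (1 - s * t\<^sup>2) = Y2 t * (1 - s * t\<^sup>2) / sqrt (1 - s * t\<^sup>2)"
          using q by (simp add: field_simps)
        hence "- (s * t) / sqrt (1 - s * t\<^sup>2) * Y1 t + Y2 t * sqrt (1 - s * t\<^sup>2) - \<beta> * (1 / sqrt (1 - s * t\<^sup>2))
            = ((1 - s * t\<^sup>2) * Y2 t - s * t * Y1 t - \<beta>) / sqrt (1 - s * t\<^sup>2)"
          by (simp add: diff_divide_distrib mult_ac)
        with DERIV_diff[OF DERIV_mult[OF root DY1[OF t]] DERIV_cmult[OF F'[OF t], of \<beta>]]
        show ?thesis by simp
      qed
      thus "((\<lambda>x. sqrt (1 - s * x\<^sup>2) * Y1 x - \<beta> * F x) has_real_derivative 0) (at t)"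
        using ode[OF t] by simp
    qed (use x in auto)
    have "Y1 0 = c 1"
      unfolding Y1_def by (subst powser_zero) (simp add: diffs_def)
    with const show ?thesis using F0 by simp
  qed
  have const: "(\<lambda>x. Y x - c 1 * F x - \<beta> / 2 * (F x)\<^sup>2) x = (\<lambda>x. Y x - c 1 * F x - \<beta> / 2 * (F x)\<^sup>2) 0"
  proof (rule DERIV_isconst3[of "-1" 1 x 0 "\<lambda>x. Y x - c 1 * F x - \<beta> / 2 * (F x)\<^sup>2"])
    fix t :: real assume "t \<in> {-1<..<1}"
    hence t: "\<bar>t\<bar> < 1" by auto
    have q: "sqrt (1 - s * t\<^sup>2) > 0" using pos[OF t] by auto
    have "((\<lambda>x. Y x - c 1 * F x - \<beta> / 2 * (F x)\<^sup>2) has_real_derivative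
        Y1 t - c 1 * (1 / sqrt (1 - s * t\<^sup>2)) - \<beta> / 2 * (2 * F t * (1 / sqrt (1 - s * t\<^sup>2)))) (at t)"
      using t by (auto intro!: derivative_eq_intros DY F')
    moreover have "Y1 t = (c 1 + \<beta> * F t) / sqrt (1 - s * t\<^sup>2)"
      using Y1[OF t] q by (simp add: field_simps)
    ultimately show "((\<lambda>x. Y x - c 1 * F x - \<beta> / 2 * (F x)\<^sup>2) has_real_derivative 0) (at t)"
      by (simp add: add_divide_distrib)
  qed (use x in auto)
  have "Y 0 = c 0"
    unfolding Y_def by (subst powser_zero) simp
  with const show ?thesis using F0 by (simp add: Y_def)
qed


section \<open>Moments of the inverse cosine and termwise integration\<close>

fun wallis :: "nat \<Rightarrow> real" where
  "wallis 0 = pi / 2"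
| "wallis (Suc 0) = 1"
| "wallis (Suc (Suc n)) = real (n + 1) / real (n + 2) * wallis n"

text \<open>
  The recursion comes from the derivative of \<open>x\<^bsup>n+1\<^esup> sqrt (1 - x\<^sup>2)\<close>, a function that vanishes at
  both endpoints. The integrands are unbounded near 1, but the gauge integral admits the
  fundamental theorem for antiderivatives that are merely continuous at the endpoints.
\<close>

lemma wallis_has_integral:
  "((\<lambda>x. x ^ n / sqrt (1 - x\<^sup>2)) has_integral wallis n) {0..1}"
proof (induction n rule: wallis.induct)
  case 1
  have "((\<lambda>x. x ^ 0 / sqrt (1 - x\<^sup>2)) has_integral arcsin 1 - arcsin 0) {0..1::real}"
  proof (rule fundamental_theorem_of_calculus_interior)
    fix x :: real assume "x \<in> {0<..<1}"
    thus "(arcsin has_vector_derivative x ^ 0 / sqrt (1 - x\<^sup>2)) (at x)"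
      using DERIV_arcsin[of x] by (simp add: has_real_derivative_iff_has_vector_derivative divide_inverse)
  qed (auto intro!: continuous_intros)
  thus ?case by simp
next
  case 2
  have "((\<lambda>x. x ^ 1 / sqrt (1 - x\<^sup>2)) has_integral (- sqrt (1 - 1\<^sup>2)) - (- sqrt (1 - 0\<^sup>2))) {0..1::real}"
  proof (rule fundamental_theorem_of_calculus_interior)
    fix x :: real assume "x \<in> {0<..<1}"
    hence "1 - 1 * x\<^sup>2 > 0" by (simp add: abs_square_less_1)
    from DERIV_minus[OF DERIV_sqrt_one_minus[OF this]]
    show "((\<lambda>x. - sqrt (1 - x\<^sup>2)) has_vector_derivative x ^ 1 / sqrt (1 - x\<^sup>2)) (at x)"
      by (simp add: has_real_derivative_iff_has_vector_derivative)
  qed (auto intro!: continuous_intros)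
  thus ?case by simp
next
  case (3 n)
  let ?G = "\<lambda>x::real. - (x ^ (n + 1) * sqrt (1 - x\<^sup>2)) / real (n + 2)"
  let ?g = "\<lambda>x::real. x ^ (n + 2) / sqrt (1 - x\<^sup>2) - real (n + 1) / real (n + 2) * (x ^ n / sqrt (1 - x\<^sup>2))"
  have "(?g has_integral ?G 1 - ?G 0) {0..1}"
  proof (rule fundamental_theorem_of_calculus_interior)
    fix x :: real assume "x \<in> {0<..<1}"
    hence p: "1 - x\<^sup>2 > 0" by (simp add: abs_square_less_1)
    define r where "r = sqrt (1 - x\<^sup>2)"
    have r: "r > 0" "r = (1 - x\<^sup>2) / r" using p real_div_sqrt[of "1 - x\<^sup>2"] by (simp_all add: r_def)
    have root: "((\<lambda>x. sqrt (1 - x\<^sup>2)) has_real_derivative - x / r) (at x)"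
      using DERIV_sqrt_one_minus[of 1 x] p by (simp add: r_def)
    have pow: "((\<lambda>x. x ^ (n + 1)) has_real_derivative real (n + 1) * x ^ n) (at x)"
      using DERIV_pow[of "n + 1" x] by simp
    have "(?G has_real_derivative - (real (n + 1) * x ^ n * r + - x / r * x ^ (n + 1)) / real (n + 2)) (at x)"
      using DERIV_cdivide[OF DERIV_minus[OF DERIV_mult[OF pow root]], of "real (n + 2)"]
      by (simp add: r_def)
    also have "real (n + 1) * x ^ n * r = real (n + 1) * x ^ n * ((1 - x\<^sup>2) / r)"
      by (simp flip: r(2))
    also have "- (real (n + 1) * x ^ n * ((1 - x\<^sup>2) / r) + - x / r * x ^ (n + 1)) / real (n + 2) =
        x ^ (n + 2) / r - real (n + 1) / real (n + 2) * (x ^ n / r)"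
    proof -
      have "- (N * X * ((1 - x\<^sup>2) / r) + - x / r * (x * X)) / (N + 1) = x\<^sup>2 * X / r - N / (N + 1) * (X / r)"
        if "N > 0" for N X :: real
        using r(1) that by (simp add: divide_simps) (simp add: algebra_simps power2_eq_square)
      from this[of "real (n + 1)" "x ^ n"] show ?thesis
        by (simp add: power_add power2_eq_square mult_ac add_ac)
    qed
    finally show "(?G has_vector_derivative ?g x) (at x)"
      by (simp add: r_def has_real_derivative_iff_has_vector_derivative)
  qed (auto intro!: continuous_intros)
  hence "(?g has_integral 0) {0..1}" by simp
  from has_integral_add[OF this has_integral_mult_right[OF 3, of "real (n+1) / real (n+2)"]]
  show ?case by simp
qed

text \<open>
  Integration by parts: the boundary term \<open>x\<^bsup>n+1\<^esup> arccos x\<close> vanishes at 0 and at 1.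
\<close>

lemma arccos_moment:
  "((\<lambda>x. x ^ n * arccos x) has_integral wallis (Suc n) / real (Suc n)) {0..1}"
proof -
  let ?G = "\<lambda>x::real. x ^ Suc n * arccos x / real (Suc n)"
  let ?g = "\<lambda>x::real. x ^ n * arccos x - 1 / real (Suc n) * (x ^ Suc n / sqrt (1 - x\<^sup>2))"
  have "(?g has_integral ?G 1 - ?G 0) {0..1}"
  proof (rule fundamental_theorem_of_calculus_interior)
    fix x :: real assume x: "x \<in> {0<..<1}"
    hence p: "1 - x\<^sup>2 > 0" by (simp add: abs_square_less_1)
    have pow: "((\<lambda>x. x ^ Suc n) has_real_derivative real (Suc n) * x ^ n) (at x)"
      using DERIV_pow[of "Suc n" x] by simp
    have "(?G has_real_derivative (real (Suc n) * x ^ n * arccos x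
        + inverse (- sqrt (1 - x\<^sup>2)) * x ^ Suc n) / real (Suc n)) (at x)"
      using x by (intro DERIV_cdivide DERIV_mult pow DERIV_arccos) auto
    also have "(real (Suc n) * x ^ n * arccos x + inverse (- sqrt (1 - x\<^sup>2)) * x ^ Suc n) / real (Suc n) = ?g x"
    proof -
      have "(N * X * A + inverse (- R) * Z) / N = X * A - 1 / N * (Z / R)" if "N > 0" for N X A R Z :: real
        using that by (cases "R = 0") (simp_all add: field_simps)
      thus ?thesis by simp
    qed
    finally have "(?G has_real_derivative ?g x) (at x)" .
    thus "(?G has_vector_derivative ?g x) (at x)"
      by (simp add: has_real_derivative_iff_has_vector_derivative)
  qed (auto intro!: continuous_intros)
  from has_integral_add[OF this has_integral_mult_right[OF wallis_has_integral[of "Suc n"], of "1 / real (Suc n)"]]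
  show ?thesis by (simp del: power_Suc)
qed

lemma wallis_nonneg: "wallis n \<ge> 0"
  by (induction n rule: wallis.induct) auto

text \<open>
  Since the moments are nonnegative, the second hypothesis says that the integrals of the absolute
  values of the terms have a finite sum, so Lebesgue's theorem permits the interchange of sum and integral.
  The work is done on the open interval, as the series need not converge at 1.
\<close>

lemma power_series_times_arccos_has_integral:
  fixes b :: "nat \<Rightarrow> real"
  assumes summ: "\<And>x. 0 < x \<Longrightarrow> x < 1 \<Longrightarrow> summable (\<lambda>n. b n * x ^ n)"
    and summ_moments: "summable (\<lambda>n. \<bar>b n * (wallis (Suc n) / real (Suc n))\<bar>)"
  shows "((\<lambda>x. (\<Sum>n. b n * x ^ n) * arccos x) has_integral
           (\<Sum>n. b n * (wallis (Suc n) / real (Suc n)))) {0..1}"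
proof -
  define M where "M = (\<lambda>n. wallis (Suc n) / real (Suc n))"
  define I where "I = {0<..<1::real}"
  define f where "f = (\<lambda>n x. indicator I x *\<^sub>R (b n * x ^ n * arccos x))"
  have M0: "M n \<ge> 0" for n unfolding M_def by (simp add: wallis_nonneg)
  have mom: "((\<lambda>x. x ^ n * arccos x) has_integral M n) I" for n
    unfolding I_def M_def using arccos_moment[of n] by (simp add: has_integral_Icc_iff_Ioo)
  have abs: "(\<lambda>x. x ^ n * arccos x) absolutely_integrable_on I" for n
    by (rule nonnegative_absolutely_integrable_1)
       (use mom[of n] in \<open>auto simp: I_def intro!: mult_nonneg_nonneg arccos_lbound\<close>)
  have int0: "integrable lebesgue (\<lambda>x. indicator I x *\<^sub>R (x ^ n * arccos x))" for n
    using abs[of n] by (simp add: set_integrable_def)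
  have val0: "integral\<^sup>L lebesgue (\<lambda>x. indicator I x *\<^sub>R (x ^ n * arccos x)) = M n" for n
    using has_integral_unique[OF mom has_integral_set_lebesgue[OF abs]]
    by (simp add: set_lebesgue_integral_def)
  have f_eq: "f n x = b n * (indicator I x *\<^sub>R (x ^ n * arccos x))" for n x
    by (simp add: f_def)
  have norm_f: "norm (f n x) = \<bar>b n\<bar> * (indicator I x *\<^sub>R (x ^ n * arccos x))" for n x
    using arccos_lbound[of x] by (auto simp: f_eq abs_mult I_def indicator_def)
  have int: "integrable lebesgue (f n)" for n
    unfolding f_eq[abs_def] by (intro integrable_mult_right int0)
  have val: "integral\<^sup>L lebesgue (f n) = b n * M n" for n
    unfolding f_eq[abs_def] using val0[of n] by simp
  have valn: "integral\<^sup>L lebesgue (\<lambda>x. norm (f n x)) = \<bar>b n * M n\<bar>" for n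
    unfolding norm_f using val0[of n] M0[of n] by (simp add: abs_mult)
  have abs_summ: "summable (\<lambda>n. norm (b n * x ^ n))" if "0 < x" "x < 1" for x
  proof -
    obtain y where y: "x < y" "y < 1" using dense \<open>x < 1\<close> by blast
    show ?thesis
      by (rule powser_insidea[where x = y]) (use summ[of y] y that in auto)
  qed
  have AE: "AE x in lebesgue. summable (\<lambda>n. norm (f n x))"
  proof (rule AE_I2)
    fix x :: real
    show "summable (\<lambda>n. norm (f n x))"
    proof (cases "x \<in> I")
      case True
      have "summable (\<lambda>n. norm (b n * x ^ n) * arccos x)"
        by (intro summable_mult2 abs_summ) (use True in \<open>auto simp: I_def\<close>)
      thus ?thesis using True unfolding norm_f by (simp add: abs_mult I_def mult.assoc)
    qed (simp add: f_def)
  qed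
  have sm: "summable (\<lambda>n. integral\<^sup>L lebesgue (\<lambda>x. norm (f n x)))"
    unfolding valn using summ_moments by (simp add: M_def)
  have sum_f: "(\<Sum>n. f n x) = indicator I x *\<^sub>R ((\<Sum>n. b n * x ^ n) * arccos x)" for x
  proof (cases "x \<in> I")
    case True
    thus ?thesis unfolding f_def using suminf_mult2[OF summ[of x], of "arccos x"] by (auto simp: I_def)
  qed (simp add: f_def)
  have si: "set_integrable lebesgue I (\<lambda>x. (\<Sum>n. b n * x ^ n) * arccos x)"
    unfolding set_integrable_def sum_f[symmetric] by (rule integrable_suminf[OF int AE sm])
  have "(\<lambda>n. b n * M n) sums (LINT x:I|lebesgue. (\<Sum>n. b n * x ^ n) * arccos x)"
    unfolding set_lebesgue_integral_def sum_f[symmetric] val[symmetric]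
    by (rule sums_integral[OF int AE sm])
  hence "(LINT x:I|lebesgue. (\<Sum>n. b n * x ^ n) * arccos x) = (\<Sum>n. b n * M n)"
    by (simp add: sums_iff)
  with has_integral_set_lebesgue[OF si] show ?thesis
    unfolding M_def I_def by (simp add: has_integral_Icc_iff_Ioo)
qed

section \<open>The integral of a quadratic polynomial in the inverse sine\<close>

text \<open>
  The Taylor coefficients of \<open>\<alpha> F + \<beta> F\<^sup>2 / 2\<close>, given by the recursion of
  \<open>ode_power_series_eq\<close> rather than by central binomial coefficients: one definition covers both
  functions and both parities.
\<close>

fun ode_coeff :: "real \<Rightarrow> real \<Rightarrow> real \<Rightarrow> nat \<Rightarrow> real" where
  "ode_coeff s \<alpha> \<beta> 0 = 0"
| "ode_coeff s \<alpha> \<beta> (Suc 0) = \<alpha>"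
| "ode_coeff s \<alpha> \<beta> (Suc (Suc n)) =
     (s * (real n)\<^sup>2 * ode_coeff s \<alpha> \<beta> n + (if n = 0 then \<beta> else 0)) / (real (n + 1) * real (n + 2))"

lemma ode_coeff_bound:
  assumes "\<bar>s\<bar> \<le> 1"
  shows "\<bar>ode_coeff s \<alpha> \<beta> n\<bar> \<le> \<bar>\<alpha>\<bar> + \<bar>\<beta>\<bar>"
proof (induction n rule: wallis.induct)
  case (3 n)
  show ?case
  proof (cases "n = 0")
    case False
    have "\<bar>s * (real n)\<^sup>2 * ode_coeff s \<alpha> \<beta> n\<bar> \<le> (1 * (real (n + 1) * real (n + 2))) * (\<bar>\<alpha>\<bar> + \<bar>\<beta>\<bar>)"
      unfolding abs_mult using assms 3
      by (intro mult_mono) (auto simp: power2_eq_square abs_mult intro!: mult_mono)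
    thus ?thesis using False by (simp add: abs_mult divide_le_eq mult_ac)
  qed simp
qed auto

lemma ode_coeff_summable:
  assumes "\<bar>s\<bar> \<le> 1" "\<bar>x\<bar> < 1"
  shows "summable (\<lambda>n. ode_coeff s \<alpha> \<beta> n * x ^ n)"
proof (rule summable_comparison_test')
  show "summable (\<lambda>n. (\<bar>\<alpha>\<bar> + \<bar>\<beta>\<bar>) * \<bar>x\<bar> ^ n)"
    using assms by (intro summable_mult summable_geometric) auto
  show "norm (ode_coeff s \<alpha> \<beta> n * x ^ n) \<le> (\<bar>\<alpha>\<bar> + \<bar>\<beta>\<bar>) * \<bar>x\<bar> ^ n" for n
    using ode_coeff_bound[OF assms(1)] by (auto simp: abs_mult power_abs intro!: mult_right_mono)
qed

text \<open>
  Passing from \<open>n = k + 1\<close> to \<open>n + 2\<close> multiplies the coefficient by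
  \<open>s n\<^sup>2 / ((n + 1) (n + 2))\<close> and the Wallis integral by \<open>(n + 1) / (n + 2)\<close>, in total by
  \<open>s n\<^sup>2 / (n + 2)\<^sup>2\<close>; the square in front absorbs everything but \<open>s\<close>. The cases \<open>n = 1\<close> and
  \<open>n = 2\<close> supply the two constants.
\<close>

lemma ode_coeff_times_wallis:
  "(real (Suc k))\<^sup>2 * (ode_coeff s \<alpha> \<beta> (Suc k) * wallis (Suc k)) =
     s ^ (k div 2) * (if even k then \<alpha> else \<beta> * pi / 2)"
proof (induction k rule: wallis.induct)
  case (3 k)
  define N where "N = real (Suc k)"
  have N: "N > 0" "real (Suc k) = N" "real (Suc (Suc (Suc k))) = N + 2"
      "real (Suc k + 1) = N + 1" "real (Suc k + 2) = N + 2"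
    by (simp_all add: N_def)
  have cancel: "(N + 2)\<^sup>2 * (s * N\<^sup>2 * C / ((N + 1) * (N + 2)) * ((N + 1) / (N + 2) * W)) = s * (N\<^sup>2 * (C * W))"
    for C W :: real
    using N(1) by (simp add: divide_simps power2_eq_square)
  have "(real (Suc (Suc (Suc k))))\<^sup>2 * (ode_coeff s \<alpha> \<beta> (Suc (Suc (Suc k))) * wallis (Suc (Suc (Suc k)))) =
      s * ((real (Suc k))\<^sup>2 * (ode_coeff s \<alpha> \<beta> (Suc k) * wallis (Suc k)))"
    by (simp only: ode_coeff.simps wallis.simps nat.distinct if_False add_0_right N cancel)
  with 3 show ?case by simp
qed (auto simp: power2_eq_square)

lemma sums_even_odd:
  fixes h :: "nat \<Rightarrow> real"
  assumes "(\<lambda>n. h (2 * n)) sums a" "(\<lambda>n. h (2 * n + 1)) sums b"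
  shows "h sums (a + b)"
proof -
  have "(\<lambda>n. if even n then h (2 * (n div 2)) else h (2 * ((n - 1) div 2) + 1)) sums (b + a)"
    by (rule sums_if[OF assms(2,1)])
  also have "(\<lambda>n. if even n then h (2 * (n div 2)) else h (2 * ((n - 1) div 2) + 1)) = h"
    by (rule ext) (auto elim!: oddE)
  finally show ?thesis by (simp add: add.commute)
qed

text \<open>
  The power series of the first factor divided by \<open>x\<close> is integrated term by term. Its term of
  degree \<open>n - 1\<close> contributes \<open>c\<^sub>n W\<^sub>n / n\<close>, which by \<open>ode_coeff_times_wallis\<close> is a constant
  depending on the parity of \<open>n\<close>, times a power of \<open>s\<close>, divided by \<open>n\<^sup>3\<close>.
\<close>

lemma arc_quadratic_times_arccos_has_integral:
  fixes F :: "real \<Rightarrow> real" and s \<alpha> \<beta> :: real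
  assumes s: "\<bar>s\<bar> \<le> 1"
    and F0: "F 0 = 0"
    and F': "\<And>x. \<bar>x\<bar> < 1 \<Longrightarrow> (F has_real_derivative 1 / sqrt (1 - s * x\<^sup>2)) (at x)"
    and odd: "(\<lambda>n. s ^ n / real (2 * n + 1) ^ 3) sums A"
    and even: "(\<lambda>n. s ^ n / real (2 * n + 2) ^ 3) sums B"
  shows "((\<lambda>x. (\<alpha> * F x + \<beta> / 2 * (F x)\<^sup>2) * arccos x / x) has_integral
           \<alpha> * A + \<beta> * pi / 2 * B) {0..1}"
proof -
  define c where "c = ode_coeff s \<alpha> \<beta>"
  have summ: "summable (\<lambda>n. c n * x ^ n)" if "\<bar>x\<bar> < 1" for x
    unfolding c_def by (rule ode_coeff_summable[OF s that])
  have shift: "(\<lambda>n. c (Suc n) * x ^ n) sums ((\<alpha> * F x + \<beta> / 2 * (F x)\<^sup>2) / x)" if "0 < x" "x < 1" for x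
  proof -
    have "(\<Sum>n. c n * x ^ n) = c 0 + c 1 * F x + \<beta> / 2 * (F x)\<^sup>2"
      using that by (intro ode_power_series_eq[OF s summ _ F0 F']) (auto simp: c_def)
    hence "(\<lambda>n. c n * x ^ n) sums (\<alpha> * F x + \<beta> / 2 * (F x)\<^sup>2)"
      using summable_sums[OF summ[of x]] that by (simp add: c_def)
    hence "(\<lambda>n. c (Suc n) * x ^ Suc n) sums (\<alpha> * F x + \<beta> / 2 * (F x)\<^sup>2)"
      by (subst sums_Suc_iff) (simp add: c_def)
    hence "(\<lambda>n. c (Suc n) * x ^ Suc n / x) sums ((\<alpha> * F x + \<beta> / 2 * (F x)\<^sup>2) / x)"
      by (rule sums_divide)
    thus ?thesis using that by simp
  qed
  have coeff: "c (Suc n) * (wallis (Suc n) / real (Suc n)) =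
      s ^ (n div 2) * (if even n then \<alpha> else \<beta> * pi / 2) / real (Suc n) ^ 3" for n
  proof -
    have "c (Suc n) * (wallis (Suc n) / real (Suc n)) =
        (real (Suc n))\<^sup>2 * (c (Suc n) * wallis (Suc n)) / real (Suc n) ^ 3"
      by (simp add: power2_eq_square power3_eq_cube del: of_nat_Suc)
    thus ?thesis unfolding c_def ode_coeff_times_wallis .
  qed
  have "(\<lambda>n. c (Suc (2 * n)) * (wallis (Suc (2 * n)) / real (Suc (2 * n)))) sums (\<alpha> * A)"
    using sums_mult[OF odd, of \<alpha>] unfolding coeff by (simp add: mult_ac)
  moreover have "(\<lambda>n. c (Suc (2 * n + 1)) * (wallis (Suc (2 * n + 1)) / real (Suc (2 * n + 1)))) sums (\<beta> * pi / 2 * B)"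
    using sums_mult[OF even, of "\<beta> * pi / 2"] unfolding coeff by (simp add: mult_ac)
  ultimately have "(\<lambda>n. c (Suc n) * (wallis (Suc n) / real (Suc n))) sums (\<alpha> * A + \<beta> * pi / 2 * B)"
    by (rule sums_even_odd)
  hence total: "(\<Sum>n. c (Suc n) * (wallis (Suc n) / real (Suc n))) = \<alpha> * A + \<beta> * pi / 2 * B"
    by (simp add: sums_iff)
  have "summable (\<lambda>n. \<bar>c (Suc n) * (wallis (Suc n) / real (Suc n))\<bar>)"
  proof (rule summable_comparison_test')
    show "summable (\<lambda>n. (\<bar>\<alpha>\<bar> + \<bar>\<beta> * pi / 2\<bar>) * inverse (real (Suc n) ^ 3))"
      by (intro summable_mult) (subst summable_Suc_iff[of "\<lambda>n. inverse (real n ^ 3)"],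
          rule inverse_power_summable, simp)
    fix n :: nat
    have "\<bar>s ^ (n div 2)\<bar> * \<bar>if even n then \<alpha> else \<beta> * pi / 2\<bar> \<le> 1 * (\<bar>\<alpha>\<bar> + \<bar>\<beta> * pi / 2\<bar>)"
      using s by (intro mult_mono) (auto simp: power_abs power_le_one)
    hence "\<bar>s ^ (n div 2)\<bar> * \<bar>if even n then \<alpha> else \<beta> * pi / 2\<bar> / real (Suc n) ^ 3
        \<le> (\<bar>\<alpha>\<bar> + \<bar>\<beta> * pi / 2\<bar>) / real (Suc n) ^ 3"
      by (intro divide_right_mono) auto
    thus "norm \<bar>c (Suc n) * (wallis (Suc n) / real (Suc n))\<bar>
        \<le> (\<bar>\<alpha>\<bar> + \<bar>\<beta> * pi / 2\<bar>) * inverse (real (Suc n) ^ 3)"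
      unfolding coeff divide_inverse[of _ "real (Suc n) ^ 3"] real_norm_def abs_idempotent abs_mult
      by simp
  qed
  (* At 0 the series has the value \<alpha>, whereas the quotient by x is 0 by convention there: the
     two integrands are compared on the open interval. *)
  hence "((\<lambda>x. (\<Sum>n. c (Suc n) * x ^ n) * arccos x) has_integral \<alpha> * A + \<beta> * pi / 2 * B) {0<..<1}"
    using power_series_times_arccos_has_integral[of "\<lambda>n. c (Suc n)"] shift
    unfolding total by (auto simp: sums_iff has_integral_Icc_iff_Ioo)
  also have "?this \<longleftrightarrow> ((\<lambda>x. (\<alpha> * F x + \<beta> / 2 * (F x)\<^sup>2) * arccos x / x) has_integral
      \<alpha> * A + \<beta> * pi / 2 * B) {0<..<1}"
    using shift by (intro has_integral_cong) (auto simp: sums_iff)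
  finally show ?thesis by (simp add: has_integral_Icc_iff_Ioo)
qed


section \<open>Sums of inverse cubes\<close>

lemma zeta_3_sums: "\<exists>Z. zeta 3 = complex_of_real Z \<and> (\<lambda>n. 1 / real (n + 1) ^ 3) sums Z"
proof -
  have "summable (\<lambda>n. inverse (real (Suc n) ^ 3))"
    by (subst summable_Suc_iff[of "\<lambda>n. inverse (real n ^ 3)"], rule inverse_power_summable) simp
  hence "summable (\<lambda>n. 1 / real (n + 1) ^ 3)" by (simp add: divide_inverse)
  then obtain Z where Z: "(\<lambda>n. 1 / real (n + 1) ^ 3) sums Z" by (auto simp: summable_def)
  have p: "z powr 3 = z ^ 3" if "z \<noteq> 0" for z :: complex
    using powr_nat'[of z 3] that by simp
  from Z have "(\<lambda>n. complex_of_real (1 / real (n + 1) ^ 3)) sums complex_of_real Z"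
    by (rule sums_of_real)
  hence "(\<lambda>n. 1 / of_nat (Suc n) powr 3) sums complex_of_real Z"
    by (subst p) (auto simp: add_ac simp flip: of_nat_Suc)
  hence "zeta 3 = complex_of_real Z"
    by (simp add: zeta_def zeta_series_def sums_iff)
  with Z show ?thesis by blast
qed

text \<open>
  The even-indexed terms are an eighth of the whole series, which leaves seven eighths for the
  odd-indexed ones. Their difference gives \<open>1 - 1 / 2\<^sup>3 + 1 / 3\<^sup>3 - \<dots> = 3 Z / 4\<close>, and an eighth of
  that is the alternating sum over even numbers.
\<close>

lemma inverse_cubes_sums:
  fixes Z :: real
  assumes Z: "(\<lambda>n. 1 / real (n + 1) ^ 3) sums Z"
  shows "(\<lambda>n. 1 / real (2 * n + 2) ^ 3) sums (Z / 8)"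
    and "(\<lambda>n. 1 / real (2 * n + 1) ^ 3) sums (7 / 8 * Z)"
    and "(\<lambda>n. (-1) ^ n / real (2 * n + 2) ^ 3) sums (3 / 32 * Z)"
proof -
  have even_terms: "1 / real (2 * n + 2) ^ 3 = 1 / real (n + 1) ^ 3 / 8" for n
  proof -
    have "real (2 * n + 2) = 2 * real (n + 1)" by simp
    thus ?thesis by (simp only: power_mult_distrib) simp
  qed
  show even: "(\<lambda>n. 1 / real (2 * n + 2) ^ 3) sums (Z / 8)"
    unfolding even_terms by (intro sums_divide Z)
  have "summable (\<lambda>n. 1 / real (2 * n + 1) ^ 3)"
  proof (rule summable_comparison_test'[OF sums_summable[OF Z]])
    show "norm (1 / real (2 * n + 1) ^ 3) \<le> 1 / real (n + 1) ^ 3" for n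
      by (auto intro!: divide_left_mono power_mono)
  qed
  then obtain S where odd: "(\<lambda>n. 1 / real (2 * n + 1) ^ 3) sums S" by (auto simp: summable_def)
  have succ: "2 * n + 1 + 1 = 2 * n + 2" for n :: nat by simp
  have "(\<lambda>n. 1 / real (n + 1) ^ 3) sums (S + Z / 8)"
  proof (rule sums_even_odd)
    show "(\<lambda>n. 1 / real (2 * n + 1 + 1) ^ 3) sums (Z / 8)"
      using even by (simp only: succ)
  qed (rule odd)
  from sums_unique2[OF Z this] have S: "S = 7 / 8 * Z" by simp
  with odd show "(\<lambda>n. 1 / real (2 * n + 1) ^ 3) sums (7 / 8 * Z)" by simp
  have "(\<lambda>n. (-1) ^ n / real (n + 1) ^ 3) sums (S + - (Z / 8))"
  proof (rule sums_even_odd)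
    show "(\<lambda>n. (-1) ^ (2 * n) / real (2 * n + 1) ^ 3) sums S"
      using odd by (simp only: power_mult power2_minus one_power2 power_one)
    have "(-1) ^ (2 * n + 1) / real (2 * n + 1 + 1) ^ 3 = - (1 / real (2 * n + 2) ^ 3)" for n
      unfolding succ by simp
    thus "(\<lambda>n. (-1) ^ (2 * n + 1) / real (2 * n + 1 + 1) ^ 3) sums (- (Z / 8))"
      using sums_minus[OF even] by (simp only:)
  qed
  hence "(\<lambda>n. (-1) ^ n / real (n + 1) ^ 3 / 8) sums ((S + - (Z / 8)) / 8)"
    by (rule sums_divide)
  also have "(\<lambda>n. (-1) ^ n / real (n + 1) ^ 3 / 8) = (\<lambda>n. (-1) ^ n * (1 / real (2 * n + 2) ^ 3))"
    unfolding even_terms by simp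
  finally show "(\<lambda>n. (-1) ^ n / real (2 * n + 2) ^ 3) sums (3 / 32 * Z)"
    by (simp add: S)
qed

lemma ln_Gamma_reflection_real:
  fixes x :: real
  assumes "0 < x" "x < 1"
  shows "ln_Gamma x + ln_Gamma (1 - x) = ln pi - ln (sin (pi * x))"
proof -
  have s: "sin (pi * x) > 0" using assms by (intro sin_gt_zero) auto
  have "complex_of_real (Gamma x * Gamma (1 - x)) = complex_of_real (pi / sin (pi * x))"
  proof -
    have arg: "1 - complex_of_real x = complex_of_real (1 - x)"
        "complex_of_real pi * complex_of_real x = complex_of_real (pi * x)" by simp_all
    show ?thesis
      using Gamma_reflection_complex[of "of_real x"]
      unfolding arg Gamma_complex_of_real sin_of_real by (simp only: of_real_mult of_real_divide)
  qed
  hence "Gamma x * Gamma (1 - x) = pi / sin (pi * x)" by (simp only: of_real_eq_iff)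
  hence "ln (Gamma x * Gamma (1 - x)) = ln (pi / sin (pi * x))" by simp
  moreover have "Gamma x > 0" "Gamma (1 - x) > 0" using assms by (auto intro: Gamma_real_pos)
  ultimately have "ln (Gamma x) + ln (Gamma (1 - x)) = ln pi - ln (sin (pi * x))"
    using s by (metis ln_div ln_mult less_irrefl pi_gt_zero)
  thus ?thesis using assms by (simp add: ln_Gamma_real_pos)
qed

text \<open>
  This is the logarithm of the reflection formula of the Gamma function, differentiated three times.
\<close>

lemma Polygamma_2_reflection_real:
  fixes x :: real
  assumes x: "0 < x" "x < 1"
  shows "Polygamma 2 (1 - x) - Polygamma 2 x = 2 * pi ^ 3 * cos (pi * x) / sin (pi * x) ^ 3"
proof -
  define I where "I = {0<..<1::real}"
  have s: "sin (pi * x) > 0" if "x \<in> I" for x using that by (intro sin_gt_zero) (auto simp: I_def)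
  have I: "x \<notin> \<int>\<^sub>\<le>\<^sub>0" "1 - x \<notin> \<int>\<^sub>\<le>\<^sub>0" if "x \<in> I" for x
    using that by (auto simp: I_def elim!: nonpos_Ints_cases)
  have transfer: "a = b"
    if "(f has_real_derivative a) (at x)" "(g has_real_derivative b) (at x)" "x \<in> I"
      "\<And>x. x \<in> I \<Longrightarrow> f x = g x" for f g :: "real \<Rightarrow> real" and a b x
    using has_field_derivative_transform_within_open[OF that(1) _ that(3,4)] that(2)
    by (intro DERIV_unique[of g a x b]) (auto simp: I_def)
  have D0: "Digamma x - Digamma (1 - x) = - (pi * cos (pi * x) / sin (pi * x))" if "x \<in> I" for x
  proof (rule transfer[OF _ _ that])
    show "((\<lambda>x. ln_Gamma x + ln_Gamma (1 - x)) has_real_derivative Digamma x - Digamma (1 - x)) (at x)"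
      using that by (auto intro!: derivative_eq_intros simp: I_def)
    show "((\<lambda>x. ln pi - ln (sin (pi * x))) has_real_derivative - (pi * cos (pi * x) / sin (pi * x))) (at x)"
      using s[OF that] by (auto intro!: derivative_eq_intros)
  qed (auto simp: I_def ln_Gamma_reflection_real)
  have D1: "Polygamma 1 x + Polygamma 1 (1 - x) = pi\<^sup>2 / (sin (pi * x))\<^sup>2" if "x \<in> I" for x
  proof (rule transfer[OF _ _ that D0])
    show "((\<lambda>x. Digamma x - Digamma (1 - x)) has_real_derivative Polygamma 1 x + Polygamma 1 (1 - x)) (at x)"
      using I[OF that] by (auto intro!: derivative_eq_intros)
    have "(- (pi * S * (S * pi)) - C * pi * (C * pi)) / (S * S) = - (pi * pi) / (S * S)"
      if "S * S + C * C = 1" for S C :: real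
    proof -
      have "- (pi * S * (S * pi)) - C * pi * (C * pi) = - (pi * pi * (S * S + C * C))"
        by (simp add: algebra_simps)
      thus ?thesis by (simp add: that)
    qed
    from this[of "sin (pi * x)" "cos (pi * x)"]
    have eq: "(- (pi * sin (pi * x) * (sin (pi * x) * pi)) - cos (pi * x) * pi * (cos (pi * x) * pi))
        / (sin (pi * x) * sin (pi * x)) = - (pi * pi) / (sin (pi * x) * sin (pi * x))"
      by (simp flip: power2_eq_square)
    show "((\<lambda>x. - (pi * cos (pi * x) / sin (pi * x))) has_real_derivative pi\<^sup>2 / (sin (pi * x))\<^sup>2) (at x)"
      using s[OF that] eq
      by (auto intro!: derivative_eq_intros simp: power2_eq_square algebra_simps)
  qed
  have "Polygamma 2 x - Polygamma 2 (1 - x) = - (2 * pi ^ 3 * cos (pi * x) / sin (pi * x) ^ 3)" if "x \<in> I" for x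
  proof (rule transfer[OF _ _ that D1])
    show "((\<lambda>x. Polygamma 1 x + Polygamma 1 (1 - x)) has_real_derivative Polygamma 2 x - Polygamma 2 (1 - x)) (at x)"
      using I[OF that] by (auto intro!: derivative_eq_intros simp: numeral_2_eq_2)
    show "((\<lambda>x. pi\<^sup>2 / (sin (pi * x))\<^sup>2) has_real_derivative
        - (2 * pi ^ 3 * cos (pi * x) / sin (pi * x) ^ 3)) (at x)"
      using s[OF that]
      by (auto intro!: derivative_eq_intros simp: power2_eq_square power3_eq_cube field_simps)
  qed
  from this[of x] x show ?thesis by (simp add: I_def)
qed

text \<open>
  The positive terms run over the numbers \<open>4 (k + 1 / 4)\<close> and the negative ones over
  \<open>4 (k + 3 / 4)\<close>, so the sum is a multiple of the difference of \<open>\<psi>''\<close> at the points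
  \<open>1 / 4\<close> and \<open>1 - 1 / 4\<close>, to which the reflection formula applies.
\<close>

lemma alternating_odd_cubes_sums: "(\<lambda>n. (-1) ^ n / real (2 * n + 1) ^ 3) sums (pi ^ 3 / 32)"
proof -
  have series: "(\<lambda>k. 1 / (4 * (x + real k)) ^ 3) sums (- Polygamma 2 x / 128)" if "x > 0" for x :: real
  proof -
    have "(\<lambda>k. inverse ((x + real k) ^ 3)) sums (- Polygamma 2 x / 2)"
      using summable_sums[OF Polygamma_converges'[of x 3]] that
      by (simp add: Polygamma_def numeral_3_eq_3 fact_numeral)
    hence "(\<lambda>k. inverse ((x + real k) ^ 3) / 64) sums (- Polygamma 2 x / 2 / 64)"
      by (rule sums_divide)
    moreover have "inverse ((x + real k) ^ 3) / 64 = 1 / (4 * (x + real k)) ^ 3" for k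
      by (simp only: power_mult_distrib) (simp add: inverse_eq_divide)
    ultimately show ?thesis by simp
  qed
  have arg: "4 * (1 / 4 + real n) = real (2 * (2 * n) + 1)" "4 * (3 / 4 + real n) = real (2 * (2 * n + 1) + 1)" for n
    by simp_all
  have "(\<lambda>n. (-1) ^ n / real (2 * n + 1) ^ 3)
      sums (- Polygamma 2 (1 / 4) / 128 + - (- Polygamma 2 (3 / 4) / 128))"
  proof (rule sums_even_odd)
    show "(\<lambda>n. (-1) ^ (2 * n) / real (2 * (2 * n) + 1) ^ 3) sums (- Polygamma 2 (1 / 4) / 128)"
      using series[of "1 / 4"] unfolding arg by simp
    show "(\<lambda>n. (-1) ^ (2 * n + 1) / real (2 * (2 * n + 1) + 1) ^ 3) sums (- (- Polygamma 2 (3 / 4) / 128))"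
      using sums_minus[OF series[of "3 / 4"]] unfolding arg by simp
  qed
  also have "- Polygamma 2 (1 / 4) / 128 + - (- Polygamma 2 (3 / 4) / 128) =
      (Polygamma 2 (1 - 1 / 4) - Polygamma 2 (1 / 4 :: real)) / 128"
    by (simp add: diff_divide_distrib)
  also have "\<dots> = (2 * pi ^ 3 * (sqrt 2 / 2) / (sqrt 2 / 2) ^ 3) / 128"
    by (subst Polygamma_2_reflection_real) (simp_all add: cos_45 sin_45)
  also have "\<dots> = pi ^ 3 / 32"
    by (simp add: power3_eq_cube)
  finally show ?thesis .
qed


section \<open>The five integrals\<close>

theorem corollary3p5:
  shows "(\<lambda>x::real. arcsin x * arccos x / x) integrable_on {0..1} \<and>
      complex_of_real (integral {0..1} (\<lambda>x::real. arcsin x * arccos x / x)) = 7 / 8 * zeta 3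
    \<and> (\<lambda>x::real. (1 / 2 * (arcsin x)\<^sup>2) * arccos x / x) integrable_on {0..1} \<and>
      complex_of_real (2 / pi * integral {0..1} (\<lambda>x::real. (1 / 2 * (arcsin x)\<^sup>2) * arccos x / x))
        = 1 / 8 * zeta 3
    \<and> (\<lambda>x::real. (arcsin x + 1 / pi * (arcsin x)\<^sup>2) * arccos x / x) integrable_on {0..1} \<and>
      complex_of_real (integral {0..1} (\<lambda>x::real. (arcsin x + 1 / pi * (arcsin x)\<^sup>2) * arccos x / x))
        = zeta 3
    \<and> (\<lambda>x::real. arsinh x * arccos x / x) integrable_on {0..1} \<and>
      integral {0..1} (\<lambda>x::real. arsinh x * arccos x / x) = pi ^ 3 / 32
    \<and> (\<lambda>x::real. (1 / 2 * (arsinh x)\<^sup>2) * arccos x / x) integrable_on {0..1} \<and>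
      complex_of_real (integral {0..1} (\<lambda>x::real. (1 / 2 * (arsinh x)\<^sup>2) * arccos x / x))
        = complex_of_real (3 * pi / 64) * zeta 3"
proof -
  obtain Z where zeta: "zeta 3 = complex_of_real Z" and Z: "(\<lambda>n. 1 / real (n + 1) ^ 3) sums Z"
    using zeta_3_sums by (elim exE conjE)
  note cubes = inverse_cubes_sums[OF Z]
  have arcsin: "((\<lambda>x. (\<alpha> * arcsin x + \<beta> / 2 * (arcsin x)\<^sup>2) * arccos x / x) has_integral
      \<alpha> * (7 / 8 * Z) + \<beta> * pi / 2 * (Z / 8)) {0..1}" for \<alpha> \<beta>
  proof (rule arc_quadratic_times_arccos_has_integral[where s = 1])
    show "(arcsin has_real_derivative 1 / sqrt (1 - 1 * x\<^sup>2)) (at x)" if "\<bar>x\<bar> < 1" for x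
      using DERIV_arcsin[of x] that by (simp add: inverse_eq_divide)
  qed (use cubes(1,2) in simp_all)
  have arsinh: "((\<lambda>x. (\<alpha> * arsinh x + \<beta> / 2 * (arsinh x)\<^sup>2) * arccos x / x) has_integral
      \<alpha> * (pi ^ 3 / 32) + \<beta> * pi / 2 * (3 / 32 * Z)) {0..1}" for \<alpha> \<beta>
  proof (rule arc_quadratic_times_arccos_has_integral[where s = "-1"])
    show "(arsinh has_real_derivative 1 / sqrt (1 - (-1) * x\<^sup>2)) (at x)" for x
      using arsinh_real_has_field_derivative[of x UNIV] by (simp add: add.commute)
  qed (use cubes(3) alternating_odd_cubes_sums in simp_all)
  have 1: "((\<lambda>x::real. arcsin x * arccos x / x) has_integral 7 / 8 * Z) {0..1}"
    using arcsin[of 1 0] by simp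
  have 2: "((\<lambda>x::real. (1 / 2 * (arcsin x)\<^sup>2) * arccos x / x) has_integral pi / 16 * Z) {0..1}"
    using arcsin[of 0 1] by (simp add: mult_ac)
  have 3: "((\<lambda>x::real. (arcsin x + 1 / pi * (arcsin x)\<^sup>2) * arccos x / x) has_integral Z) {0..1}"
    using arcsin[of 1 "2 / pi"] by simp
  have 4: "((\<lambda>x::real. arsinh x * arccos x / x) has_integral pi ^ 3 / 32) {0..1}"
    using arsinh[of 1 0] by simp
  have 5: "((\<lambda>x::real. (1 / 2 * (arsinh x)\<^sup>2) * arccos x / x) has_integral 3 * pi / 64 * Z) {0..1}"
    using arsinh[of 0 1] by (simp add: mult_ac)
  note has_integral = 1 2 3 4 5
  show ?thesis
    unfolding has_integral[THEN integral_unique] zeta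
    using has_integral[THEN has_integral_integrable] by simp
qed

end
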